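(* Let $n\ge 2$. Suppose that $\nu$ is a probability measure with a density of the form $d\nu(x)=g(x)\,d\sigma_+(x)$, where $g:\mathbb{S}^n_+\to(0,\infty)$ is some measurable function such that $a\le g\le b$ for some constants $0<a<b$. Then the $W_2$ optimal transport map $T$ between $\sigma_+$ and $\nu$ is $1$-Lipschitz if and only if $\nu=\sigma_+$.
   Context: $\mathbb{S}^n$ is the unit Euclidean sphere of $\mathbb{R}^{n+1}$, equipped with its geodesic distance $d=d_{\mathbb{S}^n}$, $d(x,y)=\arccos(x\cdot y)$. $\mathbb{S}^n_+=\{x\in\mathbb{S}^n: x_{n+1}\ge 0\}$ is the closed upper hemisphere and $\sigma_+$ is the uniform probability measure on $\mathbb{S}^n_+$. For probability measures $\mu,\nu$ on $\mathbb{S}^n$, $W_2^2(\mu,\nu)=\inf_{\pi\in\Pi(\mu,\nu)}\int d^2(x,y)\,d\pi(x,y)$, where $\Pi(\mu,\nu)$ is the set of couplings of $\mu$ and $\nu$. When $\mu$ is absolutely continuous with respect to the uniform measure on $\mathbb{S}^n$, there is a $\mu$-almost surely unique map $T$ (McCann's theorem), called the $W_2$ optimal transport map from $\mu$ to $\nu$, with $T_\#\mu=\nu$ and $\int d^2(x,T(x))\,d\mu(x)=W_2^2(\mu,\nu)$. Since this map is only determined up to $\mu$-null sets, "the optimal transport map between $\sigma_+$ and $\nu$ is $1$-Lipschitz" means that it agrees $\sigma_+$-almost everywhere with a map $\mathbb{S}^n_+\to\mathbb{S}^n_+$ that is $1$-Lipschitz for $d$. *)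

theory Defs
  imports "HOL-Probability.Probability"
begin

text \<open>
  For an index type with \<open>n\<close> elements, \<open>\<real>\<^sup>n\<^sup>+\<^sup>1\<close> is realised as
  \<open>\<real>\<^sup>n \<times> \<real>\<close>, whose product norm and inner product are the Euclidean ones; the last
  coordinate \<open>x\<^sub>n\<^sub>+\<^sub>1\<close> is \<open>snd x\<close>.
\<close>

type_synonym 'n euclid_suc = "(real ^ 'n) \<times> real"

definition unit_sphere :: "('n::finite) euclid_suc set" where
  "unit_sphere = sphere 0 1"

definition upper_hemisphere :: "('n::finite) euclid_suc set" where
  "upper_hemisphere = {x \<in> unit_sphere. snd x \<ge> 0}"

definition sphere_dist :: "('n::finite) euclid_suc \<Rightarrow> 'n euclid_suc \<Rightarrow> real" where
  "sphere_dist x y = arccos (x \<bullet> y)"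

text \<open>
  The uniform measure on the sphere is the law of \<open>X / |X|\<close> for \<open>X\<close> uniform in the unit
  ball, i.e. the normalised surface measure.  Since \<open>sgn 0 = 0\<close>, the centre of the ball is not
  sent to the sphere, but it is a null set.
\<close>

definition uniform_sphere :: "('n::finite) euclid_suc measure" where
  "uniform_sphere =
     restrict_space (distr (uniform_measure lborel (ball 0 1)) borel sgn) unit_sphere"

text \<open>As a measure on the whole sphere, concentrated on the hemisphere.\<close>

definition uniform_hemisphere :: "('n::finite) euclid_suc measure" where
  "uniform_hemisphere = uniform_measure uniform_sphere upper_hemisphere"

definition couplings :: "'a measure \<Rightarrow> 'b measure \<Rightarrow> ('a \<times> 'b) measure set" where
  "couplings \<mu> \<nu> =
     {\<pi>. sets \<pi> = sets (\<mu> \<Otimes>\<^sub>M \<nu>) \<and> distr \<pi> \<mu> fst = \<mu> \<and> distr \<pi> \<nu> snd = \<nu>}"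

definition W2_squared ::
    "('n::finite) euclid_suc measure \<Rightarrow> 'n euclid_suc measure \<Rightarrow> ennreal" where
  "W2_squared \<mu> \<nu> =
     (INF \<pi> \<in> couplings \<mu> \<nu>. \<integral>\<^sup>+ p. ennreal ((sphere_dist (fst p) (snd p))\<^sup>2) \<partial>\<pi>)"

definition optimal_transport_map ::
    "('n::finite) euclid_suc measure \<Rightarrow> 'n euclid_suc measure \<Rightarrow>
     ('n euclid_suc \<Rightarrow> 'n euclid_suc) \<Rightarrow> bool" where
  "optimal_transport_map \<mu> \<nu> T \<longleftrightarrow>
     T \<in> measurable \<mu> \<nu> \<and> distr \<mu> \<nu> T = \<nu> \<and>
     (\<integral>\<^sup>+ x. ennreal ((sphere_dist x (T x))\<^sup>2) \<partial>\<mu>) = W2_squared \<mu> \<nu>"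

text \<open>
  A transport map from the uniform measure on the hemisphere is only determined up to null sets,
  so being \<open>1\<close>-Lipschitz is a property of its almost-everywhere class.
\<close>

definition one_Lipschitz_hemisphere :: "(('n::finite) euclid_suc \<Rightarrow> 'n euclid_suc) \<Rightarrow> bool" where
  "one_Lipschitz_hemisphere T \<longleftrightarrow>
     (\<exists>S. S \<in> upper_hemisphere \<rightarrow> upper_hemisphere \<and>
          (\<forall>x\<in>upper_hemisphere. \<forall>y\<in>upper_hemisphere.
             sphere_dist (S x) (S y) \<le> sphere_dist x y) \<and>
          (AE x in uniform_hemisphere. T x = S x))"

lemma sets_uniform_sphere [measurable_cong]:
  "sets uniform_sphere = sets (restrict_space borel unit_sphere)"
  by (simp add: uniform_sphere_def sets_restrict_space)

lemma space_uniform_sphere: "space uniform_sphere = unit_sphere"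
  by (simp add: uniform_sphere_def space_restrict_space)

lemma sets_uniform_hemisphere [measurable_cong]:
  "sets uniform_hemisphere = sets (restrict_space borel unit_sphere)"
  by (simp add: uniform_hemisphere_def sets_uniform_sphere)

lemma space_uniform_hemisphere: "space uniform_hemisphere = unit_sphere"
  by (simp add: uniform_hemisphere_def space_uniform_sphere)

lemma unit_sphere_borel [measurable]: "unit_sphere \<in> sets borel"
  by (simp add: unit_sphere_def)

lemma borel_measurable_sgn_euclid_suc [measurable]:
  "(sgn :: ('n::finite) euclid_suc \<Rightarrow> _) \<in> borel_measurable borel"
  unfolding sgn_div_norm by measurable

lemma upper_hemisphere_borel [measurable]:
  "(upper_hemisphere :: ('n::finite) euclid_suc set) \<in> sets borel"
proof -
  have "closed {x :: 'n euclid_suc. 0 \<le> snd x}"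
    by (intro closed_Collect_le continuous_intros)
  moreover have "(upper_hemisphere :: 'n euclid_suc set) = unit_sphere \<inter> {x. 0 \<le> snd x}"
    by (auto simp: upper_hemisphere_def)
  ultimately show ?thesis
    by (metis borel_closed sets.Int unit_sphere_borel)
qed

lemma uniform_sphere_cone:
  fixes A :: "('n::finite) euclid_suc set"
  assumes "A \<in> sets borel" "A \<subseteq> unit_sphere"
  shows "emeasure uniform_sphere A =
           emeasure lborel {x \<in> ball 0 1. sgn x \<in> A} / emeasure lborel (ball (0 :: 'n euclid_suc) 1)"
proof -
  have "sgn -` A \<in> sets (borel :: 'n euclid_suc measure)"
    using measurable_sets[OF borel_measurable_sgn_euclid_suc assms(1)] by simp
  moreover have "ball 0 1 \<inter> sgn -` A = {x \<in> ball 0 1. sgn x \<in> A}"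
    by auto
  ultimately show ?thesis
    using assms by (simp add: uniform_sphere_def emeasure_restrict_space emeasure_distr)
qed

lemma emeasure_lborel_open_nonzero:
  fixes U :: "'a::euclidean_space set"
  assumes "open U" "U \<noteq> {}"
  shows "emeasure lborel U \<noteq> 0"
proof
  assume "emeasure lborel U = 0"
  then have "U \<in> null_sets lborel"
    using assms(1) by (auto simp: null_sets_def)
  then have "negligible U"
    by (metis negligible_iff_null_sets null_sets_completionI)
  with open_not_negligible assms show False by blast
qed

lemma emeasure_lborel_ball_euclid_suc:
  "emeasure lborel (ball (0 :: ('n::finite) euclid_suc) 1) \<noteq> 0"
  "emeasure lborel (ball (0 :: ('n::finite) euclid_suc) 1) \<noteq> \<infinity>"
proof -
  show "emeasure lborel (ball (0 :: 'n euclid_suc) 1) \<noteq> \<infinity>"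
    using emeasure_bounded_finite[of "ball (0 :: 'n euclid_suc) 1"] by auto
  show "emeasure lborel (ball (0 :: 'n euclid_suc) 1) \<noteq> 0"
    by (rule emeasure_lborel_open_nonzero) auto
qed

lemma prob_space_uniform_sphere: "prob_space (uniform_sphere :: ('n::finite) euclid_suc measure)"
proof
  let ?B = "ball (0 :: 'n euclid_suc) 1"
  have "{x \<in> ?B. sgn x \<in> unit_sphere} = ?B - {0}"
    by (auto simp: unit_sphere_def norm_sgn)
  moreover have "emeasure lborel (?B - {0}) = emeasure lborel ?B"
    by (subst emeasure_Diff_null_set) auto
  ultimately show "emeasure uniform_sphere (space (uniform_sphere :: 'n euclid_suc measure)) = 1"
    using emeasure_lborel_ball_euclid_suc[where 'n = 'n]
    by (simp add: space_uniform_sphere uniform_sphere_cone ennreal_divide_self less_top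
        del: mem_ball mem_ball_0)
qed

lemma prob_space_uniform_hemisphere:
  "prob_space (uniform_hemisphere :: ('n::finite) euclid_suc measure)"
proof -
  let ?B = "ball (0 :: 'n euclid_suc) 1"
  let ?U = "{x \<in> ?B. 0 < snd x}"
  let ?H = "{x \<in> ?B. sgn x \<in> (upper_hemisphere :: 'n euclid_suc set)}"
  interpret S: prob_space "uniform_sphere :: 'n euclid_suc measure"
    by (rule prob_space_uniform_sphere)
  have "open ?U"
  proof -
    have "open {x :: 'n euclid_suc. 0 < snd x}"
      by (intro open_Collect_less continuous_intros)
    moreover have "?U = ?B \<inter> {x. 0 < snd x}" by auto
    ultimately show ?thesis by (metis open_Int open_ball)
  qed
  moreover have "(0, 1 / 2) \<in> ?U"
    by (simp add: dist_norm norm_Pair)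
  ultimately have "emeasure lborel ?U \<noteq> 0"
    by (intro emeasure_lborel_open_nonzero) blast+
  moreover have "?U \<subseteq> ?H"
    by (auto simp: upper_hemisphere_def unit_sphere_def norm_sgn sgn_div_norm divide_simps)
  moreover have "?H \<in> sets lborel"
    by measurable
  ultimately have "emeasure lborel ?H \<noteq> 0"
    by (metis (no_types, lifting) emeasure_mono le_zero_eq)
  then have "emeasure uniform_sphere (upper_hemisphere :: 'n euclid_suc set) \<noteq> 0"
    using emeasure_lborel_ball_euclid_suc(2)[where 'n = 'n]
    by (subst uniform_sphere_cone) (auto simp: upper_hemisphere_def[symmetric] ennreal_divide_eq_0_iff,
        auto simp: upper_hemisphere_def)
  then show ?thesis
    unfolding uniform_hemisphere_def
    by (rule prob_space_uniform_measure) simp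
qed

end

theory Submission
  imports Defs
begin

text \<open>
  If \<open>\<nu>\<close> is the uniform measure \<open>\<sigma>\<close> on the hemisphere \<open>H\<close>, the diagonal coupling shows that
  the optimal cost is zero, so that an optimal map is almost everywhere the identity.

  For the converse, let \<open>S\<close> be a \<open>1\<close>-Lipschitz representative of \<open>T\<close>. The argument is one of
  rigidity. Since \<open>\<nu>\<close> has a positive density, it charges every cap of \<open>H\<close>, whereas it lives on the
  compact set \<open>S ` H\<close>; thus \<open>S\<close> is onto (\<open>continuous_representative_onto\<close>). A nonexpansive
  map of a compact metric space onto itself is an isometry
  (\<open>nonexpansive_onto_compact_isometry\<close>). On the unit sphere an isometry preserves inner
  products, and as \<open>H\<close> contains the standard basis, \<open>S\<close> is the restriction of an orthogonal
  map \<open>L\<close> (\<open>inner_preserving_imp_orthogonal\<close>). Orthogonal maps preserve Lebesgue measure,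
  hence the uniform measure on the sphere, and since \<open>L\<close> maps \<open>H\<close> onto itself it preserves
  \<open>\<sigma>\<close> (\<open>uniform_hemisphere_distr_orthogonal\<close>). Therefore \<open>\<nu>\<close>, the image of \<open>\<sigma>\<close> under
  \<open>L\<close>, equals \<open>\<sigma>\<close>.
\<close>

section \<open>Nonexpansive surjections of compact metric spaces\<close>

lemma funpow_in: "h \<in> K \<rightarrow> K \<Longrightarrow> u \<in> K \<Longrightarrow> (h ^^ n) u \<in> K"
  by (induction n) auto

lemma expansive_funpow:
  fixes h :: "'a::metric_space \<Rightarrow> 'a"
  assumes h: "h \<in> K \<rightarrow> K"
    and expand: "\<And>u v. u \<in> K \<Longrightarrow> v \<in> K \<Longrightarrow> dist u v \<le> dist (h u) (h v)"
    and "u \<in> K" "v \<in> K"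
  shows "dist u v \<le> dist ((h ^^ n) u) ((h ^^ n) v)"
proof (induction n)
  case (Suc n)
  also have "dist ((h ^^ n) u) ((h ^^ n) v) \<le> dist (h ((h ^^ n) u)) (h ((h ^^ n) v))"
    using assms(3,4) funpow_in[OF h] by (intro expand)
  finally show ?case by simp
qed simp

text \<open>
  Poincare recurrence without a measure: by compactness of \<open>K \<times> K\<close> the pairs
  \<open>(h\<^sup>n x, h\<^sup>n y)\<close> come arbitrarily close to one another at two times \<open>m < n\<close>, and as
  \<open>h\<^sup>m\<close> does not decrease distances, both points are then already close to their images
  under \<open>h\<^sup>n\<^sup>-\<^sup>m\<close>. Following the two orbits jointly makes one exponent serve both points.
\<close>

lemma compact_orbits_recur:
  fixes K :: "'a::metric_space set" and h :: "'a \<Rightarrow> 'a"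
  assumes K: "compact K" and h: "h \<in> K \<rightarrow> K"
    and expand: "\<And>u v. u \<in> K \<Longrightarrow> v \<in> K \<Longrightarrow> dist u v \<le> dist (h u) (h v)"
    and x: "x \<in> K" and y: "y \<in> K" and e: "0 < e"
  obtains k where "dist x ((h ^^ Suc k) x) < e" "dist y ((h ^^ Suc k) y) < e"
proof -
  note iter_in = funpow_in[OF h]
  have iter_expand: "dist u v \<le> dist ((h ^^ n) u) ((h ^^ n) v)" if "u \<in> K" "v \<in> K" for n u v
    using h expand that by (rule expansive_funpow)
  define z where "z n = ((h ^^ n) x, (h ^^ n) y)" for n
  have "compact (K \<times> K)"
    using K by (intro compact_Times)
  moreover have "\<forall>n. z n \<in> K \<times> K"
    using iter_in x y by (auto simp: z_def)
  ultimately obtain l r where r: "strict_mono (r :: nat \<Rightarrow> nat)" and lim: "(z \<circ> r) \<longlonglongrightarrow> l"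
    unfolding compact_def by metis
  then have "Cauchy (z \<circ> r)"
    by (intro LIMSEQ_imp_Cauchy)
  then obtain N where N: "\<And>m n. m \<ge> N \<Longrightarrow> n \<ge> N \<Longrightarrow> dist (z (r m)) (z (r n)) < e"
    using e unfolding Cauchy_def comp_def by metis
  have less: "r N < r (Suc N)"
    using r by (simp add: strict_mono_Suc_iff)
  define k where "k = r (Suc N) - r N - 1"
  have shift: "r (Suc N) = r N + Suc k"
    using less by (simp add: k_def)
  have split: "(h ^^ r (Suc N)) u = (h ^^ r N) ((h ^^ Suc k) u)" for u
    unfolding shift funpow_add by simp
  have close: "dist (z (r N)) (z (r (Suc N))) < e"
    by (intro N) auto
  have "dist u ((h ^^ Suc k) u) < e" if "u \<in> {x, y}" for u
  proof -
    have "u \<in> K"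
      using that x y by auto
    then have "dist u ((h ^^ Suc k) u) \<le> dist ((h ^^ r N) u) ((h ^^ r (Suc N)) u)"
      unfolding split by (intro iter_expand iter_in)
    also have "\<dots> \<le> dist (z (r N)) (z (r (Suc N)))"
      using that dist_fst_le[of "z (r N)" "z (r (Suc N))"] dist_snd_le[of "z (r N)" "z (r (Suc N))"]
      by (auto simp: z_def)
    finally show ?thesis
      using close by simp
  qed
  then show ?thesis
    using that by blast
qed

text \<open>
  A right inverse \<open>h\<close> of \<open>f\<close> does not decrease distances, so some \<open>h\<^sup>k\<^sup>+\<^sup>1\<close> nearly fixes
  both \<open>x\<close> and \<open>y\<close>. Applying \<open>f\<close> shows that \<open>f x\<close> and \<open>f y\<close> are close to \<open>h\<^sup>k x\<close> and
  \<open>h\<^sup>k y\<close>, whose distance is at least that of \<open>x\<close> and \<open>y\<close>.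
\<close>

lemma nonexpansive_onto_compact_isometry:
  fixes f :: "'a::metric_space \<Rightarrow> 'a"
  assumes K: "compact K" and onto: "f ` K = K"
    and nonexp: "\<And>u v. u \<in> K \<Longrightarrow> v \<in> K \<Longrightarrow> dist (f u) (f v) \<le> dist u v"
    and x: "x \<in> K" and y: "y \<in> K"
  shows "dist (f x) (f y) = dist x y"
proof (rule antisym)
  show "dist x y \<le> dist (f x) (f y)"
  proof (rule field_le_epsilon)
    fix e :: real assume "0 < e"
    define h where "h = inv_into K f"
    have h: "h \<in> K \<rightarrow> K" and fh: "\<And>u. u \<in> K \<Longrightarrow> f (h u) = u"
      using onto by (auto simp: h_def inv_into_into f_inv_into_f)
    have expand: "dist u v \<le> dist (h u) (h v)" if "u \<in> K" "v \<in> K" for u v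
      using nonexp[of "h u" "h v"] h that by (auto simp: fh)
    note iter_in = funpow_in[OF h]
    have iter_expand: "dist u v \<le> dist ((h ^^ n) u) ((h ^^ n) v)" if "u \<in> K" "v \<in> K" for n u v
      using h expand that by (rule expansive_funpow)
    obtain k where k: "dist x ((h ^^ Suc k) x) < e / 2" "dist y ((h ^^ Suc k) y) < e / 2"
      using compact_orbits_recur[OF K h expand x y, of "e / 2"] \<open>0 < e\<close> by auto
    have near: "dist (f u) ((h ^^ k) u) \<le> dist u ((h ^^ Suc k) u)" if "u \<in> K" for u
      using nonexp[OF that iter_in[OF that, of "Suc k"]] fh[OF iter_in[OF that, of k]] by simp
    have "dist x y \<le> dist ((h ^^ k) x) ((h ^^ k) y)"
      using x y by (rule iter_expand)
    also have "\<dots> \<le> dist ((h ^^ k) x) (f x) + dist (f x) (f y) + dist (f y) ((h ^^ k) y)"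
      using dist_triangle[of "(h ^^ k) x" "(h ^^ k) y" "f x"] dist_triangle[of "f x" "(h ^^ k) y" "f y"]
      by simp
    also have "\<dots> \<le> dist (f x) (f y) + e"
      using near[OF x] near[OF y] k by (simp add: dist_commute)
    finally show "dist x y \<le> dist (f x) (f y) + e" .
  qed
qed (use nonexp x y in blast)

section \<open>Orthogonal maps and Lebesgue measure\<close>

text \<open>
  The images of the standard basis are orthonormal and hence a basis, and the coordinates of
  \<open>S x\<close> in it are the inner products \<open>S x \<bullet> S b = x \<bullet> b\<close>, which are linear in \<open>x\<close>.
\<close>

lemma inner_preserving_imp_orthogonal:
  fixes S :: "'a::euclidean_space \<Rightarrow> 'a"
  assumes "Basis \<subseteq> H"
    and inner: "\<And>x y. x \<in> H \<Longrightarrow> y \<in> H \<Longrightarrow> S x \<bullet> S y = x \<bullet> y"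
  obtains L where "orthogonal_transformation L" "\<And>x. x \<in> H \<Longrightarrow> S x = L x"
proof -
  define L where "L x = (\<Sum>b\<in>Basis. (x \<bullet> b) *\<^sub>R S b)" for x
  have lin: "linear L"
    unfolding L_def
    by (intro linearI)
      (simp_all add: inner_add_left scaleR_add_left sum.distrib scaleR_sum_right)
  have inner_L: "S x \<bullet> L y = x \<bullet> y" if "x \<in> H" for x y
  proof -
    have "S x \<bullet> L y = (\<Sum>b\<in>Basis. (y \<bullet> b) * (x \<bullet> b))"
      using that assms by (auto simp: L_def inner_sum_right intro!: sum.cong)
    also have "\<dots> = x \<bullet> y"
      by (subst (3) euclidean_inner) (simp add: mult.commute)
    finally show ?thesis .
  qed
  have "L x \<bullet> L y = x \<bullet> y" for x y
  proof -
    have "L x \<bullet> L y = (\<Sum>b\<in>Basis. (x \<bullet> b) * (b \<bullet> y))"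
      using inner_L assms(1) by (subst L_def) (auto simp: inner_sum_left intro!: sum.cong)
    also have "\<dots> = x \<bullet> y"
      by (subst (3) euclidean_inner) (simp add: inner_commute)
    finally show ?thesis .
  qed
  with lin have orth: "orthogonal_transformation L"
    by (simp add: orthogonal_transformation_def)
  have "S x = L x" if "x \<in> H" for x
  proof -
    have "S x \<bullet> L y = L x \<bullet> L y" for y
      using inner_L[OF that] orth by (simp add: orthogonal_transformation_def)
    then have "S x \<bullet> w = L x \<bullet> w" for w
      using orthogonal_transformation_surj[OF orth] by (metis surjD)
    then show ?thesis
      by (metis vector_eq_rdot)
  qed
  with orth show ?thesis
    using that by blast
qed

lemma borel_measurable_orthogonal:
  fixes L :: "'a::euclidean_space \<Rightarrow> 'a"
  assumes "orthogonal_transformation L"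
  shows "L \<in> borel_measurable borel"
  using orthogonal_transformation_linear[OF assms]
  by (intro borel_measurable_continuous_onI linear_continuous_on linear_conv_bounded_linear[THEN iffD1])

text \<open>
  This is uniqueness of Haar measure. The image measure is again invariant under translations,
  and evaluating
  \<open>\<integral>\<integral> indicator A (L x) * indicator B (L x + y) \<partial>x \<partial>y\<close>
  in both orders gives \<open>\<mu> A * \<lambda> B = \<lambda> A * \<mu> B\<close> for Lebesgue measure \<open>\<lambda>\<close> and its image
  \<open>\<mu>\<close>. The unit ball \<open>B\<close> is mapped to itself and thus fixes the constant to be \<open>1\<close>.
\<close>

lemma lborel_distr_orthogonal:
  fixes L :: "'a::euclidean_space \<Rightarrow> 'a"
  assumes orth: "orthogonal_transformation L"
  shows "distr lborel borel L = lborel"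
proof (rule measure_eqI)
  have lin: "linear L"
    using orth by (rule orthogonal_transformation_linear)
  have [measurable]: "L \<in> borel_measurable borel"
    using orth by (rule borel_measurable_orthogonal)
  fix A :: "'a set" assume "A \<in> sets (distr lborel borel L)"
  then have [measurable]: "A \<in> sets borel"
    by simp
  define B :: "'a set" where "B = ball 0 1"
  have [measurable]: "B \<in> sets borel"
    by (simp add: B_def)
  have translate: "(\<integral>\<^sup>+x. f (c + x) \<partial>lborel) = (\<integral>\<^sup>+x. f x \<partial>lborel)"
    if [measurable]: "f \<in> borel_measurable borel" for f :: "'a \<Rightarrow> ennreal" and c
    by (subst (2) lborel_distr_plus[of c, symmetric]) (simp add: nn_integral_distr)
  have reflect: "(\<integral>\<^sup>+x. f (- x) \<partial>lborel) = (\<integral>\<^sup>+x. f x \<partial>lborel)"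
    if [measurable]: "f \<in> borel_measurable borel" for f :: "'a \<Rightarrow> ennreal"
    by (subst (2) lborel_affine[of "-1" 0]) (simp_all add: nn_integral_density nn_integral_distr)
  have pull: "emeasure (distr lborel borel L) C = (\<integral>\<^sup>+x. indicator C (L x) \<partial>lborel)"
    if [measurable]: "C \<in> sets borel" for C
    using nn_integral_distr[of L lborel borel "indicator C"] by simp
  have "emeasure (distr lborel borel L) A * emeasure lborel B
      = (\<integral>\<^sup>+x. (\<integral>\<^sup>+y. indicator A (L x) * indicator B y \<partial>lborel) \<partial>lborel)"
    by (simp add: pull nn_integral_cmult nn_integral_multc)
  also have "\<dots> = (\<integral>\<^sup>+x. (\<integral>\<^sup>+y. indicator A (L x) * indicator B (L x + y) \<partial>lborel) \<partial>lborel)"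
    by (intro nn_integral_cong translate[symmetric]) simp
  also have "\<dots> = (\<integral>\<^sup>+y. (\<integral>\<^sup>+x. indicator A (L x) * indicator B (L x + y) \<partial>lborel) \<partial>lborel)"
    by (intro lborel_pair.Fubini'[symmetric]) measurable
  \<comment> \<open>Translating the domain of \<open>L\<close> by a preimage of \<open>y\<close> moves \<open>y\<close> from \<open>B\<close> to \<open>A\<close>.\<close>
  also have "\<dots> = (\<integral>\<^sup>+y. (\<integral>\<^sup>+x. indicator A (L x - y) * indicator B (L x) \<partial>lborel) \<partial>lborel)"
  proof (rule nn_integral_cong)
    fix y
    obtain c where "y = L c"
      using orthogonal_transformation_surj[OF orth] by (metis surjD)
    then have "(\<integral>\<^sup>+x. indicator A (L x) * indicator B (L x + y) \<partial>lborel)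
      = (\<integral>\<^sup>+x. (\<lambda>x. indicator A (L x - y) * indicator B (L x)) (c + x) \<partial>lborel)"
      by (simp add: linear_add[OF lin] add.commute)
    also have "\<dots> = (\<integral>\<^sup>+x. indicator A (L x - y) * indicator B (L x) \<partial>lborel)"
      by (rule translate) measurable
    finally show "(\<integral>\<^sup>+x. indicator A (L x) * indicator B (L x + y) \<partial>lborel)
      = (\<integral>\<^sup>+x. indicator A (L x - y) * indicator B (L x) \<partial>lborel)" .
  qed
  also have "\<dots> = (\<integral>\<^sup>+x. (\<integral>\<^sup>+y. indicator A (L x - y) * indicator B (L x) \<partial>lborel) \<partial>lborel)"
    by (intro lborel_pair.Fubini') measurable
  also have "\<dots> = (\<integral>\<^sup>+x. emeasure lborel A * indicator B (L x) \<partial>lborel)"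
  proof (rule nn_integral_cong)
    fix x
    have "(\<integral>\<^sup>+y. indicator A (L x - y) \<partial>lborel) = (\<integral>\<^sup>+y. indicator A (L x + y) \<partial>lborel :: ennreal)"
      using reflect[of "\<lambda>y. indicator A (L x + y)"] by simp
    also have "\<dots> = emeasure lborel A"
      using translate[of "indicator A" "L x"] by simp
    finally show "(\<integral>\<^sup>+y. indicator A (L x - y) * indicator B (L x) \<partial>lborel)
      = emeasure lborel A * indicator B (L x)"
      by (simp add: nn_integral_multc)
  qed
  also have "\<dots> = emeasure lborel A * emeasure lborel B"
  proof -
    have "(\<integral>\<^sup>+x. emeasure lborel A * indicator B (L x) \<partial>lborel)
        = (\<integral>\<^sup>+x. emeasure lborel A * indicator B x \<partial>lborel)"
      using orthogonal_transformation_norm[OF orth]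
      by (intro nn_integral_cong) (simp add: B_def indicator_def)
    then show ?thesis
      by (simp add: nn_integral_cmult)
  qed
  finally have eq: "emeasure (distr lborel borel L) A * emeasure lborel B
      = emeasure lborel A * emeasure lborel B" .
  have "emeasure lborel B \<noteq> 0"
    unfolding B_def by (rule emeasure_lborel_open_nonzero) auto
  moreover have "emeasure lborel B \<noteq> \<infinity>"
    using emeasure_bounded_finite[of B] by (auto simp: B_def)
  ultimately show "emeasure (distr lborel borel L) A = emeasure lborel A"
    using eq by (metis mult_divide_eq_ennreal infinity_ennreal_def)
qed simp


section \<open>The uniform measure on the hemisphere\<close>

lemma upper_hemisphere_sets_uniform_sphere:
  "upper_hemisphere \<in> sets (uniform_sphere :: ('n::finite) euclid_suc measure)"
  using upper_hemisphere_borel unit_sphere_borel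
  by (simp add: sets_uniform_sphere sets_restrict_space_iff) (auto simp: upper_hemisphere_def)

text \<open>
  An orthogonal map preserves the unit ball and commutes with the radial projection, so it maps
  cones over subsets of the sphere to cones, and these have the same Lebesgue measure.
\<close>

lemma uniform_sphere_orthogonal_vimage:
  fixes L :: "('n::finite) euclid_suc \<Rightarrow> 'n euclid_suc"
  assumes orth: "orthogonal_transformation L"
    and [measurable]: "A \<in> sets borel" and A: "A \<subseteq> unit_sphere"
  shows "emeasure uniform_sphere (L -` A) = emeasure uniform_sphere A"
proof -
  have lin: "linear L"
    using orth by (rule orthogonal_transformation_linear)
  have [measurable]: "L \<in> borel_measurable borel"
    using orth by (rule borel_measurable_orthogonal)
  note norm_L = orthogonal_transformation_norm[OF orth]
  have sgn_L: "sgn (L x) = L (sgn x)" for x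
    by (simp add: sgn_div_norm norm_L linear_cmul[OF lin])
  have LA: "L -` A \<in> sets borel"
    using measurable_sets[of L borel borel A] by simp
  have LA_sub: "L -` A \<subseteq> unit_sphere"
  proof
    fix x assume "x \<in> L -` A"
    then have "norm (L x) = 1"
      using A by (auto simp: unit_sphere_def)
    then show "x \<in> unit_sphere"
      by (simp add: unit_sphere_def norm_L)
  qed
  define C where "C = {x \<in> ball 0 1. sgn x \<in> A}"
  have "C = ball 0 1 \<inter> sgn -` A"
    by (auto simp: C_def)
  then have C: "C \<in> sets borel"
    using measurable_sets[OF borel_measurable_sgn_euclid_suc, of A] by simp
  have "{x \<in> ball 0 1. sgn x \<in> L -` A} = L -` C"
    by (auto simp: C_def sgn_L norm_L)
  moreover have "emeasure lborel (L -` C) = emeasure lborel C"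
    using emeasure_distr[of L lborel borel C] C lborel_distr_orthogonal[OF orth] by simp
  ultimately show ?thesis
    by (simp add: uniform_sphere_cone LA LA_sub A C_def del: mem_ball mem_ball_0)
qed

lemma uniform_hemisphere_distr_orthogonal:
  fixes L :: "('n::finite) euclid_suc \<Rightarrow> 'n euclid_suc"
  assumes orth: "orthogonal_transformation L"
    and onto: "L ` upper_hemisphere = upper_hemisphere"
  shows "L \<in> measurable uniform_hemisphere uniform_hemisphere"
    and "distr uniform_hemisphere uniform_hemisphere L = uniform_hemisphere"
proof -
  have "L \<in> measurable (restrict_space borel unit_sphere) (restrict_space borel unit_sphere)"
    using orthogonal_transformation_norm[OF orth] borel_measurable_orthogonal[OF orth]
    by (intro measurable_restrict_space3) (auto simp: unit_sphere_def)
  then show meas: "L \<in> measurable uniform_hemisphere uniform_hemisphere"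
    by (simp cong: measurable_cong_sets add: sets_uniform_hemisphere)
  have H_iff: "L x \<in> upper_hemisphere \<longleftrightarrow> x \<in> upper_hemisphere" for x
    using onto orthogonal_transformation_inj[OF orth] by (metis inj_image_mem_iff)
  show "distr uniform_hemisphere uniform_hemisphere L = uniform_hemisphere"
  proof (rule measure_eqI)
    fix A assume "A \<in> sets (distr uniform_hemisphere uniform_hemisphere L)"
    then have A: "A \<in> sets (uniform_sphere :: 'n euclid_suc measure)"
      by (simp add: sets_uniform_hemisphere sets_uniform_sphere)
    then have A_borel: "A \<in> sets borel" and "A \<subseteq> unit_sphere"
      by (auto simp: sets_uniform_sphere sets_restrict_space)
    note H = upper_hemisphere_sets_uniform_sphere
    have pre: "L -` A \<inter> unit_sphere \<in> sets (uniform_sphere :: 'n euclid_suc measure)"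
      using measurable_sets[OF meas, of A] A
      by (simp add: sets_uniform_hemisphere sets_uniform_sphere space_uniform_hemisphere)
    have "emeasure (distr uniform_hemisphere uniform_hemisphere L) A
        = emeasure uniform_hemisphere (L -` A \<inter> unit_sphere)"
      using A by (subst emeasure_distr[OF meas])
        (simp_all add: sets_uniform_hemisphere sets_uniform_sphere space_uniform_hemisphere)
    also have "\<dots> = emeasure uniform_sphere (upper_hemisphere \<inter> (L -` A \<inter> unit_sphere))
        / emeasure uniform_sphere (upper_hemisphere :: 'n euclid_suc set)"
      unfolding uniform_hemisphere_def by (rule emeasure_uniform_measure[OF H pre])
    also have "upper_hemisphere \<inter> (L -` A \<inter> unit_sphere) = L -` (upper_hemisphere \<inter> A)"
      using H_iff by (auto simp: upper_hemisphere_def)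
    also have "emeasure uniform_sphere (L -` (upper_hemisphere \<inter> A))
        = emeasure uniform_sphere (upper_hemisphere \<inter> A)"
      using A_borel upper_hemisphere_borel
      by (intro uniform_sphere_orthogonal_vimage[OF orth]) (auto simp: upper_hemisphere_def)
    also have "\<dots> / emeasure uniform_sphere (upper_hemisphere :: 'n euclid_suc set)
        = emeasure uniform_hemisphere A"
      unfolding uniform_hemisphere_def by (rule emeasure_uniform_measure[OF H A, symmetric])
    finally show "emeasure (distr uniform_hemisphere uniform_hemisphere L) A = emeasure uniform_hemisphere A" .
  qed simp
qed

text \<open>
  The cone over the cap contains a nonempty open set. The point of the cap in question may lie
  on the equator, so it is first moved towards the pole.
\<close>

lemma uniform_hemisphere_ball_nonzero:
  fixes y :: "('n::finite) euclid_suc"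
  assumes y: "y \<in> upper_hemisphere" and e: "0 < e"
  shows "emeasure uniform_hemisphere (upper_hemisphere \<inter> ball y e) \<noteq> 0"
proof -
  define A where "A = upper_hemisphere \<inter> ball y e"
  define v :: "'n euclid_suc" where "v = (0, 1)"
  define U where "U = {x. 0 < snd x} \<inter> (- {0} \<inter> sgn -` ball y e) \<inter> ball 0 1"
  have nrm: "norm y = 1" and "0 \<le> snd y"
    using y by (auto simp: upper_hemisphere_def unit_sphere_def)
  have A: "A \<in> sets borel" "A \<subseteq> unit_sphere"
    using upper_hemisphere_borel by (auto simp: A_def) (auto simp: upper_hemisphere_def)
  have "open (- {0} \<inter> sgn -` ball y e)"
    by (rule continuous_open_preimage) (auto intro!: continuous_intros)
  moreover have "open {x :: 'n euclid_suc. 0 < snd x}"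
    by (intro open_Collect_less continuous_intros)
  ultimately have "open U"
    unfolding U_def by (metis open_Int open_ball)
  have "((\<lambda>t. sgn (y + t *\<^sub>R v)) \<longlongrightarrow> sgn (y + 0 *\<^sub>R v)) (at_right 0)"
    using nrm by (intro tendsto_intros) auto
  then have "((\<lambda>t. sgn (y + t *\<^sub>R v)) \<longlongrightarrow> y) (at_right 0)"
    using nrm by (simp add: sgn_div_norm)
  then have "\<forall>\<^sub>F t in at_right 0. dist (sgn (y + t *\<^sub>R v)) y < e"
    using e by (rule tendstoD)
  then have "\<forall>\<^sub>F t in at_right (0::real). dist (sgn (y + t *\<^sub>R v)) y < e \<and> 0 < t"
    by (intro eventually_conj eventually_at_right_less)
  then obtain t where t: "dist (sgn (y + t *\<^sub>R v)) y < e" "0 < t"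
    using eventually_happens by force
  define x where "x = (1 / 2) *\<^sub>R sgn (y + t *\<^sub>R v)"
  have pos: "0 < snd (y + t *\<^sub>R v)"
    using t \<open>0 \<le> snd y\<close> by (simp add: v_def)
  then have nz: "y + t *\<^sub>R v \<noteq> 0"
    by (metis less_irrefl snd_zero)
  have "0 < snd x"
    using pos nz by (simp add: x_def sgn_div_norm)
  moreover have "sgn x = sgn (y + t *\<^sub>R v)"
    using nz by (simp add: x_def sgn_scaleR sgn_div_norm[of "sgn _"] norm_sgn)
  moreover have "norm x < 1"
    using nz by (simp add: x_def norm_sgn)
  ultimately have "x \<in> U"
    using t by (auto simp: U_def dist_commute)
  with \<open>open U\<close> have "emeasure lborel U \<noteq> 0"
    by (intro emeasure_lborel_open_nonzero) auto
  moreover have "U \<subseteq> {x \<in> ball 0 1. sgn x \<in> A}"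
    by (auto simp: U_def A_def upper_hemisphere_def unit_sphere_def norm_sgn sgn_div_norm)
  moreover have "{x \<in> ball 0 1. sgn x \<in> A} \<in> sets lborel"
  proof -
    have "{x \<in> ball 0 1. sgn x \<in> A} = ball 0 1 \<inter> sgn -` A"
      by auto
    then show ?thesis
      using measurable_sets[OF borel_measurable_sgn_euclid_suc A(1)] by simp
  qed
  ultimately have "emeasure lborel {x \<in> ball 0 1. sgn x \<in> A} \<noteq> 0"
    using emeasure_mono[of U "{x \<in> ball 0 1. sgn x \<in> A}" lborel] by fastforce
  then have S: "emeasure uniform_sphere A \<noteq> 0"
    using emeasure_lborel_ball_euclid_suc(2)[where 'n='n]
    by (simp add: uniform_sphere_cone[OF A] ennreal_divide_eq_0_iff del: mem_ball mem_ball_0)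
  interpret S: prob_space "uniform_sphere :: 'n euclid_suc measure"
    by (rule prob_space_uniform_sphere)
  have "A \<in> sets uniform_sphere"
    using A unit_sphere_borel by (simp add: sets_uniform_sphere sets_restrict_space_iff)
  moreover have "upper_hemisphere \<inter> A = A"
    by (auto simp: A_def)
  ultimately show ?thesis
    using S unfolding A_def[symmetric] uniform_hemisphere_def
    by (simp add: ennreal_divide_eq_0_iff upper_hemisphere_sets_uniform_sphere)
qed

lemma AE_uniform_hemisphere: "AE x in uniform_hemisphere. x \<in> (upper_hemisphere :: ('n::finite) euclid_suc set)"
  unfolding uniform_hemisphere_def
  by (rule AE_uniform_measureI[OF upper_hemisphere_sets_uniform_sphere]) auto

section \<open>Geodesic and Euclidean distance\<close>

lemma abs_inner_unit_sphere: "x \<in> unit_sphere \<Longrightarrow> y \<in> unit_sphere \<Longrightarrow> \<bar>x \<bullet> y\<bar> \<le> 1"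
  using Cauchy_Schwarz_ineq2[of x y] by (simp add: unit_sphere_def)

lemma inner_unit_sphere:
  "x \<in> unit_sphere \<Longrightarrow> y \<in> unit_sphere \<Longrightarrow> x \<bullet> y = 1 - (dist x y)\<^sup>2 / 2"
  by (simp add: unit_sphere_def dist_norm power2_norm_eq_inner norm_eq_1 inner_diff inner_commute[of y x]
      diff_divide_distrib)

text \<open>
  Both distances are monotone functions of the inner product. Statements about the geodesic
  distance can therefore be treated with the metric space structure of the ambient space.
\<close>

lemma sphere_dist_le_iff:
  assumes "u \<in> unit_sphere" "v \<in> unit_sphere" "x \<in> unit_sphere" "y \<in> unit_sphere"
  shows "sphere_dist u v \<le> sphere_dist x y \<longleftrightarrow> dist u v \<le> dist x y"
  using assms
  by (simp add: sphere_dist_def arccos_le_mono abs_inner_unit_sphere)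
    (simp add: inner_unit_sphere power_mono_iff)

lemma sphere_dist_eq_0_iff:
  assumes "x \<in> unit_sphere" "y \<in> unit_sphere"
  shows "sphere_dist x y = 0 \<longleftrightarrow> x = y"
  using assms abs_inner_unit_sphere[OF assms]
  by (simp add: sphere_dist_def arccos_eq_0_iff abs_le_iff) (simp add: inner_unit_sphere)


lemma borel_measurable_sphere_dist:
  assumes [measurable]: "f \<in> borel_measurable M" "h \<in> borel_measurable M"
    and sphere: "\<And>x. x \<in> space M \<Longrightarrow> f x \<in> unit_sphere \<and> h x \<in> unit_sphere"
  shows "(\<lambda>x. sphere_dist (f x) (h x)) \<in> borel_measurable M"
proof -
  have [measurable]: "(\<lambda>t::real. arccos (max (-1) (min 1 t))) \<in> borel_measurable borel"
    by (intro borel_measurable_continuous_onI continuous_intros) auto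
  \<comment> \<open>The function arccos is continuous only on \<open>{-1..1}\<close>, hence the truncation.\<close>
  have "(\<lambda>x. arccos (max (-1) (min 1 (f x \<bullet> h x)))) \<in> borel_measurable M"
    by measurable
  moreover have "arccos (max (-1) (min 1 (f x \<bullet> h x))) = sphere_dist (f x) (h x)" if "x \<in> space M" for x
    using sphere[OF that] abs_inner_unit_sphere[of "f x" "h x"]
    by (simp add: sphere_dist_def)
  ultimately show ?thesis
    by (rule measurable_cong[THEN iffD1, rotated])
qed

lemma measurable_uniform_hemisphere_borel:
  assumes "f \<in> measurable M uniform_hemisphere"
  shows "f \<in> borel_measurable M"
  using assms by (simp add: measurable_cong_sets[OF refl sets_uniform_hemisphere] measurable_restrict_space2_iff)

section \<open>Optimal transport of the uniform measure to itself\<close>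

lemma W2_squared_uniform_hemisphere_self:
  "W2_squared uniform_hemisphere (uniform_hemisphere :: ('n::finite) euclid_suc measure) = 0"
proof -
  let ?\<mu> = "uniform_hemisphere :: 'n euclid_suc measure"
  let ?\<pi> = "distr ?\<mu> (?\<mu> \<Otimes>\<^sub>M ?\<mu>) (\<lambda>x. (x, x))"
  have "?\<pi> \<in> couplings ?\<mu> ?\<mu>"
    by (simp add: couplings_def distr_distr comp_def)
  moreover have "(\<integral>\<^sup>+ p. ennreal ((sphere_dist (fst p) (snd p))\<^sup>2) \<partial>?\<pi>) = 0"
  proof -
    have [measurable]: "(\<lambda>p. sphere_dist (fst p) (snd p)) \<in> borel_measurable (?\<mu> \<Otimes>\<^sub>M ?\<mu>)"
      by (intro borel_measurable_sphere_dist measurable_uniform_hemisphere_borel)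
        (auto simp: space_pair_measure space_uniform_hemisphere)
    have "(\<integral>\<^sup>+ p. ennreal ((sphere_dist (fst p) (snd p))\<^sup>2) \<partial>?\<pi>)
        = (\<integral>\<^sup>+ x. ennreal ((sphere_dist x x)\<^sup>2) \<partial>?\<mu>)"
      by (simp add: nn_integral_distr)
    also have "\<dots> = (\<integral>\<^sup>+ x. 0 \<partial>?\<mu>)"
      by (intro nn_integral_cong) (simp add: space_uniform_hemisphere sphere_dist_eq_0_iff)
    finally show ?thesis
      by simp
  qed
  ultimately show ?thesis
    unfolding W2_squared_def by (intro le_zero_eq[THEN iffD1] INF_lower2[of ?\<pi>]) simp_all
qed

lemma optimal_transport_to_self_AE_id:
  fixes T :: "('n::finite) euclid_suc \<Rightarrow> 'n euclid_suc"
  assumes "optimal_transport_map uniform_hemisphere uniform_hemisphere T"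
  shows "AE x in uniform_hemisphere. T x = x"
proof -
  let ?\<mu> = "uniform_hemisphere :: 'n euclid_suc measure"
  have T: "T \<in> measurable ?\<mu> ?\<mu>"
    and cost: "(\<integral>\<^sup>+ x. ennreal ((sphere_dist x (T x))\<^sup>2) \<partial>?\<mu>) = 0"
    using assms by (auto simp: optimal_transport_map_def W2_squared_uniform_hemisphere_self)
  have T_sphere: "T x \<in> unit_sphere" if "x \<in> unit_sphere" for x
    using measurable_space[OF T] that by (simp add: space_uniform_hemisphere)
  have [measurable]: "(\<lambda>x. sphere_dist x (T x)) \<in> borel_measurable ?\<mu>"
    using T T_sphere
    by (intro borel_measurable_sphere_dist measurable_uniform_hemisphere_borel)
      (auto simp: space_uniform_hemisphere)
  have "AE x in ?\<mu>. ennreal ((sphere_dist x (T x))\<^sup>2) = 0"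
    using cost by (subst (asm) nn_integral_0_iff_AE) auto
  then show ?thesis
    using AE_space
  proof eventually_elim
    case (elim x)
    then have "sphere_dist x (T x) = 0" and "x \<in> unit_sphere"
      by (auto simp: space_uniform_hemisphere ennreal_eq_0_iff)
    then show ?case
      using T_sphere[of x] by (simp add: sphere_dist_eq_0_iff)
  qed
qed

section \<open>Lipschitz transport maps on the hemisphere\<close>

lemma compact_upper_hemisphere: "compact (upper_hemisphere :: ('n::finite) euclid_suc set)"
proof -
  have "upper_hemisphere = sphere 0 1 \<inter> {x :: 'n euclid_suc. 0 \<le> snd x}"
    by (auto simp: upper_hemisphere_def unit_sphere_def)
  moreover have "closed {x :: 'n euclid_suc. 0 \<le> snd x}"
    by (intro closed_Collect_le continuous_intros)
  ultimately show ?thesis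
    by (metis compact_Int_closed compact_sphere)
qed

lemma Basis_subset_upper_hemisphere: "Basis \<subseteq> (upper_hemisphere :: ('n::finite) euclid_suc set)"
  by (auto simp: upper_hemisphere_def unit_sphere_def Basis_prod_def norm_Pair)

text \<open>
  The image of \<open>S\<close> is compact, and the image measure is concentrated on it. If it missed a
  point of the hemisphere, it would miss a cap around that point, which carries positive mass.
\<close>

lemma continuous_representative_onto:
  fixes S :: "('n::finite) euclid_suc \<Rightarrow> 'n euclid_suc"
  assumes S: "continuous_on upper_hemisphere S" "S \<in> upper_hemisphere \<rightarrow> upper_hemisphere"
    and T: "T \<in> measurable uniform_hemisphere uniform_hemisphere"
    and TS: "AE x in uniform_hemisphere. T x = S x"
    and charges: "\<And>A. A \<in> sets uniform_hemisphere \<Longrightarrow> emeasure uniform_hemisphere A \<noteq> 0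
      \<Longrightarrow> emeasure (distr uniform_hemisphere uniform_hemisphere T) A \<noteq> 0"
  shows "S ` upper_hemisphere = upper_hemisphere"
proof (rule antisym)
  let ?\<mu> = "uniform_hemisphere :: 'n euclid_suc measure"
  show "S ` upper_hemisphere \<subseteq> upper_hemisphere"
    using S(2) by auto
  have closed: "closed (S ` upper_hemisphere)"
    using S(1) compact_upper_hemisphere by (intro compact_imp_closed compact_continuous_image)
  show "upper_hemisphere \<subseteq> S ` upper_hemisphere"
  proof (rule ccontr)
    assume "\<not> upper_hemisphere \<subseteq> S ` upper_hemisphere"
    then obtain y where y: "y \<in> upper_hemisphere" "y \<in> - S ` upper_hemisphere"
      by blast
    then obtain e where e: "0 < e" "ball y e \<subseteq> - S ` upper_hemisphere"
      using open_contains_ball_eq[OF open_Compl[OF closed]] by blast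
    define A where "A = upper_hemisphere \<inter> ball y e"
    have A: "A \<in> sets ?\<mu>"
      using upper_hemisphere_borel unit_sphere_borel
      by (simp add: A_def sets_uniform_hemisphere sets_restrict_space_iff) (auto simp: upper_hemisphere_def)
    have "emeasure ?\<mu> A \<noteq> 0"
      unfolding A_def using y(1) e(1) by (rule uniform_hemisphere_ball_nonzero)
    then have "emeasure (distr ?\<mu> ?\<mu> T) A \<noteq> 0"
      by (rule charges[OF A])
    moreover have "AE x in ?\<mu>. x \<notin> T -` A \<inter> space ?\<mu>"
      using TS AE_uniform_hemisphere
    proof eventually_elim
      case (elim x)
      then have "T x \<in> S ` upper_hemisphere"
        by auto
      then show ?case
        using e(2) by (auto simp: A_def)
    qed
    then have "emeasure ?\<mu> (T -` A \<inter> space ?\<mu>) = 0"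
      using measurable_sets[OF T A] by (subst AE_iff_measurable[symmetric]) auto
    ultimately show False
      using A T by (simp add: emeasure_distr)
  qed
qed

lemma emeasure_density_nonzero:
  assumes f: "f \<in> borel_measurable M" and A: "A \<in> sets M"
    and pos: "AE x in M. f x \<noteq> 0"
    and nz: "emeasure M A \<noteq> 0"
  shows "emeasure (density M f) A \<noteq> 0"
proof
  assume "emeasure (density M f) A = 0"
  then have "AE x in M. f x * indicator A x = 0"
    using f A by (simp add: emeasure_density nn_integral_0_iff_AE)
  then have "AE x in M. x \<notin> A"
    using pos by eventually_elim (auto simp: indicator_def split: if_splits)
  then show False
    using nz A by (simp add: AE_iff_null_sets[symmetric] null_sets_def)
qed

theorem corollary7:
  fixes g :: "('n::finite) euclid_suc \<Rightarrow> real"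
    and \<nu> :: "'n euclid_suc measure"
    and T :: "'n euclid_suc \<Rightarrow> 'n euclid_suc"
    and a b :: real
  assumes "CARD('n) \<ge> 2"
    and "g \<in> borel_measurable (restrict_space borel upper_hemisphere)"
    and "\<forall>x\<in>upper_hemisphere. 0 < g x"
    and "0 < a" and "a < b"
    and "\<forall>x\<in>upper_hemisphere. a \<le> g x \<and> g x \<le> b"
    and "\<nu> = density uniform_hemisphere (\<lambda>x. ennreal (g x) * indicator upper_hemisphere x)"
    and "prob_space \<nu>"
    and "optimal_transport_map uniform_hemisphere \<nu> T"
  shows "one_Lipschitz_hemisphere T \<longleftrightarrow> \<nu> = uniform_hemisphere"
proof
  let ?\<mu> = "uniform_hemisphere :: 'n euclid_suc measure"
  let ?H = "upper_hemisphere :: 'n euclid_suc set"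
  let ?f = "\<lambda>x. ennreal (g x) * indicator ?H x"
  have sets_\<nu>: "sets \<nu> = sets ?\<mu>"
    by (simp add: assms(7))
  have T: "T \<in> measurable ?\<mu> ?\<mu>" and push: "distr ?\<mu> ?\<mu> T = \<nu>"
    using assms(9) sets_\<nu> measurable_cong_sets[OF refl sets_\<nu>, of ?\<mu>]
      distr_cong[OF refl sets_\<nu>, of ?\<mu> T T]
    by (auto simp: optimal_transport_map_def)
  have H_sphere: "?H \<subseteq> unit_sphere"
    by (auto simp: upper_hemisphere_def)
  {
    assume "\<nu> = ?\<mu>"
    then have "AE x in ?\<mu>. T x = x"
      using assms(9) by (intro optimal_transport_to_self_AE_id) simp
    then show "one_Lipschitz_hemisphere T"
      unfolding one_Lipschitz_hemisphere_def by (intro exI[of _ "\<lambda>x. x"]) auto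
  }
  assume "one_Lipschitz_hemisphere T"
  then obtain S where S: "S \<in> ?H \<rightarrow> ?H"
    and lip: "\<And>x y. x \<in> ?H \<Longrightarrow> y \<in> ?H \<Longrightarrow> sphere_dist (S x) (S y) \<le> sphere_dist x y"
    and TS: "AE x in ?\<mu>. T x = S x"
    unfolding one_Lipschitz_hemisphere_def by blast
  have nonexp: "dist (S x) (S y) \<le> dist x y" if "x \<in> ?H" "y \<in> ?H" for x y
    using lip[OF that] sphere_dist_le_iff[of "S x" "S y" x y] S H_sphere that by blast
  then have cont: "continuous_on ?H S"
    unfolding continuous_on_iff by (meson le_less_trans)
  have "(\<lambda>x. ennreal (g x)) \<in> borel_measurable (restrict_space borel ?H)"
    using assms(2) by measurable
  then have "?f \<in> borel_measurable borel"
    using upper_hemisphere_borel by (subst (asm) borel_measurable_restrict_space_iff_ennreal) simp_all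
  then have "?f \<in> borel_measurable (restrict_space borel unit_sphere)"
    by (rule measurable_restrict_space1)
  then have f: "?f \<in> borel_measurable ?\<mu>"
    by (simp add: measurable_cong_sets[OF sets_uniform_hemisphere refl])
  have "AE x in ?\<mu>. ?f x \<noteq> 0"
    using AE_uniform_hemisphere by eventually_elim (use assms(3) in \<open>auto simp: ennreal_eq_0_iff not_le\<close>)
  then have "emeasure \<nu> A \<noteq> 0" if "A \<in> sets ?\<mu>" "emeasure ?\<mu> A \<noteq> 0" for A
    unfolding assms(7) using f that by (intro emeasure_density_nonzero)
  then have onto: "S ` ?H = ?H"
    by (intro continuous_representative_onto[OF cont S T TS]) (simp add: push)
  have "S x \<bullet> S y = x \<bullet> y" if "x \<in> ?H" "y \<in> ?H" for x y
  proof -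
    have "dist (S x) (S y) = dist x y"
      using nonexpansive_onto_compact_isometry[OF compact_upper_hemisphere onto nonexp that] by simp
    moreover have "S x \<in> unit_sphere" "S y \<in> unit_sphere" "x \<in> unit_sphere" "y \<in> unit_sphere"
      using S H_sphere that by auto
    ultimately show ?thesis
      by (simp add: inner_unit_sphere)
  qed
  then obtain L where L: "orthogonal_transformation L" and SL: "\<And>x. x \<in> ?H \<Longrightarrow> S x = L x"
    using inner_preserving_imp_orthogonal[OF Basis_subset_upper_hemisphere, of S] by blast
  have L_onto: "L ` ?H = ?H"
    using onto SL by (metis image_cong)
  have "AE x in ?\<mu>. T x = L x"
    using TS AE_uniform_hemisphere by eventually_elim (simp add: SL)
  then have "distr ?\<mu> ?\<mu> T = distr ?\<mu> ?\<mu> L"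
    using T uniform_hemisphere_distr_orthogonal(1)[OF L L_onto] by (intro distr_cong_AE) auto
  then show "\<nu> = ?\<mu>"
    using push uniform_hemisphere_distr_orthogonal(2)[OF L L_onto] by simp
qed

end
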